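(* Let $L\colon[a,b]\times\mathbb{R}^{n}\times\mathbb{R}^n\to\mathbb{R}^d$ be of class $C^1$. Let $M\subset\mathcal{X}$ be an infimizer for $\overline J$. Given $\zeta\in C^+\setminus\{0\}$, suppose that there exists a $\zeta$-solution $y_\zeta\in M$. Then for any $v\in C_0^1([a,b];\mathbb{R}^n)$ $$\widehat J'_\zeta(0;M)(v)=S_{(\varphi'_{\zeta,M}(0),\zeta)}(v)=H^+(\zeta).$$
   Context: Let $a<b$ be real, $n\ge 1$, $d>1$ integers, $A,B\in\mathbb{R}^n$, and let $\emptyset\neq C\subsetneq\mathbb{R}^d$ be a closed convex cone with dual $C^+=\{\zeta\in\mathbb{R}^d\mid \zeta\cdot z\ge 0\ \forall z\in C\}$. Let $\mathcal{F}(\mathbb{R}^d,C)=\{D\subseteq\mathbb{R}^d\mid D=\mathrm{cl}(D+C)\}$. Put $\mathcal{X}=\{y\in C^1([a,b];\mathbb{R}^n)\mid y(a)=A,\ y(b)=B\}$, $C^1_0([a,b];\mathbb{R}^n)=\{v\in C^1([a,b];\mathbb{R}^n)\mid v(a)=v(b)=0\}$, $J(y)=\int_a^bL(t,y(t),\dot y(t))\,dt\in\mathbb{R}^d$, $\overline J(y)=J(y)+C$, $J_\zeta(y)=\zeta\cdot J(y)$. A set $M\subseteq\mathcal{X}$ is an infimizer for $\overline J$ if $\mathrm{cl}\bigcup_{y\in M}\overline J(y)=\mathrm{cl}\bigcup_{y\in\mathcal{X}}\overline J(y)$. A $\zeta$-solution is an arc $y_\zeta\in\mathcal{X}$ with $J_\zeta(y_\zeta)=\inf_{y\in\mathcal{X}}J_\zeta(y)$.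 The inf-translation of $\overline J$ by $M$ is $\widehat J(\cdot;M)\colon C^1_0([a,b];\mathbb{R}^n)\to\mathcal{F}(\mathbb{R}^d,C)$, $\widehat J(v;M)=\mathrm{cl}\bigcup_{y\in M}\overline J(y+v)$, and $\varphi_{\zeta,M}(v)=\inf_{z\in\widehat J(v;M)}\zeta\cdot z=\inf_{y\in M}J_\zeta(y+v)$; $\varphi'_{\zeta,M}(0)$ is its Fréchet derivative at $0$ (with respect to the $C^1$ norm), which exists under the hypotheses of the claim. For $\zeta\in C^+\setminus\{0\}$: $H^+(\zeta)=\{z\in\mathbb{R}^d\mid\zeta\cdot z\ge0\}$; for a continuous linear functional $\xi$, $S_{(\xi,\zeta)}(v)=\{z\in\mathbb{R}^d\mid\zeta\cdot z\ge\xi(v)\}$; for $D,E\in\mathcal{F}(\mathbb{R}^d,C)$ the $\zeta$-difference is $D-_\zeta E=\{z\in\mathbb{R}^d\mid z+E\subseteq\mathrm{cl}(D+H^+(\zeta))\}=\{z\mid\zeta\cdot z+\inf_{e\in E}\zeta\cdot e\ge\inf_{x\in D}\zeta\cdot x\}$. The directional derivative with respect to $\zeta$ of a set-valued $f$ at $x_0$ in direction $v$ is $f'_\zeta(x_0)(v)=\lim_{s\to0^+}\frac1s\big(f(x_0+sv)-_\zeta f(x_0)\big)$, and $\widehat J'_\zeta(0;M)(v)$ is this derivative for $f=\widehat J(\cdot;M)$, $x_0=0$. Here for a sequence of sets $\lim_{k\to\infty}D_k=\{z\in\mathbb{R}^d\mid \exists z_k\in D_k\ (k\in\mathbb{N}),\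 z_k\to z\}$, and $\lim_{s\to0^+}D_s$ is the set equal to $\lim_{k\to\infty}D_{s_k}$ for every sequence $s_k\to0$, $s_k>0$. *)

theory Defs
  imports "HOL-Analysis.Analysis"
begin

text \<open>Arcs on \<open>[a,b]\<close> are functions on the whole real line of which only the values on \<open>{a..b}\<close>
  matter. All derivatives are relative to the domain, so they are one-sided at the end points.\<close>

definition C1_on :: "'a::real_normed_vector set \<Rightarrow> ('a \<Rightarrow> 'b::real_normed_vector) \<Rightarrow> bool" where
  "C1_on S f \<longleftrightarrow> (\<exists>f' :: 'a \<Rightarrow> 'a \<Rightarrow>\<^sub>L 'b.
     (\<forall>x\<in>S. (f has_derivative blinfun_apply (f' x)) (at x within S)) \<and> continuous_on S f')"

definition dot :: "real \<Rightarrow> real \<Rightarrow> (real \<Rightarrow> 'b::real_normed_vector) \<Rightarrow> real \<Rightarrow> 'b" where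
  "dot a b y t = vector_derivative y (at t within {a..b})"

definition C1_norm :: "real \<Rightarrow> real \<Rightarrow> (real \<Rightarrow> 'b::real_normed_vector) \<Rightarrow> real" where
  "C1_norm a b v = (SUP t\<in>{a..b}. norm (v t)) + (SUP t\<in>{a..b}. norm (dot a b v t))"

definition admissible_arcs ::
  "real \<Rightarrow> real \<Rightarrow> 'b::real_normed_vector \<Rightarrow> 'b \<Rightarrow> (real \<Rightarrow> 'b) set" where
  "admissible_arcs a b A B = {y. C1_on {a..b} y \<and> y a = A \<and> y b = B}"

definition C1_0 :: "real \<Rightarrow> real \<Rightarrow> (real \<Rightarrow> 'b::real_normed_vector) set" where
  "C1_0 a b = {v. C1_on {a..b} v \<and> v a = 0 \<and> v b = 0}"

definition dual_cone :: "'c::real_inner set \<Rightarrow> 'c set" where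
  "dual_cone C = {\<zeta>. \<forall>z\<in>C. \<zeta> \<bullet> z \<ge> 0}"

definition H_plus :: "'c::real_inner \<Rightarrow> 'c set" where
  "H_plus \<zeta> = {z. \<zeta> \<bullet> z \<ge> 0}"

definition S_set :: "((real \<Rightarrow> 'b) \<Rightarrow> real) \<Rightarrow> 'c::real_inner \<Rightarrow> (real \<Rightarrow> 'b) \<Rightarrow> 'c set" where
  "S_set \<xi> \<zeta> v = {z. \<zeta> \<bullet> z \<ge> \<xi> v}"

definition J :: "real \<Rightarrow> real \<Rightarrow> (real \<times> 'b::real_normed_vector \<times> 'b \<Rightarrow> 'c::euclidean_space) \<Rightarrow>
    (real \<Rightarrow> 'b) \<Rightarrow> 'c" where
  "J a b L y = integral {a..b} (\<lambda>t. L (t, y t, dot a b y t))"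

definition J_bar :: "real \<Rightarrow> real \<Rightarrow> (real \<times> 'b::real_normed_vector \<times> 'b \<Rightarrow> 'c::euclidean_space) \<Rightarrow> 'c set \<Rightarrow>
    (real \<Rightarrow> 'b) \<Rightarrow> 'c set" where
  "J_bar a b L C y = {J a b L y + c | c. c \<in> C}"

definition J_scalar :: "real \<Rightarrow> real \<Rightarrow> (real \<times> 'b::real_normed_vector \<times> 'b \<Rightarrow> 'c::euclidean_space) \<Rightarrow> 'c \<Rightarrow>
    (real \<Rightarrow> 'b) \<Rightarrow> real" where
  "J_scalar a b L \<zeta> y = \<zeta> \<bullet> J a b L y"

definition infimizer :: "('x \<Rightarrow> 'c::topological_space set) \<Rightarrow> 'x set \<Rightarrow> 'x set \<Rightarrow> bool" where
  "infimizer F X M \<longleftrightarrow>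
     M \<subseteq> X \<and> closure (\<Union>y\<in>M. F y) = closure (\<Union>y\<in>X. F y)"

text \<open>The infimum is taken in the extended reals: a real \<open>Inf\<close> is an unspecified number
  when the functional is unbounded below.\<close>

definition zeta_solution :: "real \<Rightarrow> real \<Rightarrow> 'b::real_normed_vector \<Rightarrow> 'b \<Rightarrow> (real \<times> 'b \<times> 'b \<Rightarrow> 'c::euclidean_space) \<Rightarrow> 'c \<Rightarrow>
    (real \<Rightarrow> 'b) \<Rightarrow> bool" where
  "zeta_solution a b A B L \<zeta> y \<longleftrightarrow>
     y \<in> admissible_arcs a b A B \<and>
     ereal (J_scalar a b L \<zeta> y) = (INF x\<in>admissible_arcs a b A B. ereal (J_scalar a b L \<zeta> x))"

definition J_hat :: "real \<Rightarrow> real \<Rightarrow> (real \<times> 'b::real_normed_vector \<times> 'b \<Rightarrow> 'c::euclidean_space) \<Rightarrow> 'c set \<Rightarrow>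
    (real \<Rightarrow> 'b) set \<Rightarrow> (real \<Rightarrow> 'b) \<Rightarrow> 'c set" where
  "J_hat a b L C M v = closure (\<Union>y\<in>M. J_bar a b L C (\<lambda>t. y t + v t))"

text \<open>For \<open>v \<in> C1_0 a b\<close> this is the infimum of a nonempty set that is bounded below as soon as
  \<open>\<zeta> \<in> dual_cone C\<close>, \<open>C\<close> is nonempty and \<open>M\<close> consists of admissible arcs and contains a
  \<open>\<zeta>\<close>-solution, so the real-valued \<open>Inf\<close> is then the extended-real infimum.\<close>

definition phi :: "real \<Rightarrow> real \<Rightarrow> (real \<times> 'b::real_normed_vector \<times> 'b \<Rightarrow> 'c::euclidean_space) \<Rightarrow> 'c set \<Rightarrow> 'c \<Rightarrow>
    (real \<Rightarrow> 'b) set \<Rightarrow> (real \<Rightarrow> 'b) \<Rightarrow> real" where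
  "phi a b L C \<zeta> M v = (INF z\<in>J_hat a b L C M v. \<zeta> \<bullet> z)"

definition C1_0_dual ::
  "real \<Rightarrow> real \<Rightarrow> ((real \<Rightarrow> 'b::real_normed_vector) \<Rightarrow> real) \<Rightarrow> bool" where
  "C1_0_dual a b \<xi> \<longleftrightarrow>
     (\<forall>u\<in>C1_0 a b. \<forall>v\<in>C1_0 a b. \<xi> (\<lambda>t. u t + v t) = \<xi> u + \<xi> v) \<and>
     (\<forall>c. \<forall>v\<in>C1_0 a b. \<xi> (\<lambda>t. c *\<^sub>R v t) = c * \<xi> v) \<and>
     (\<exists>K. \<forall>v\<in>C1_0 a b. \<bar>\<xi> v\<bar> \<le> K * C1_norm a b v)"

text \<open>Frechet derivatives of functionals on \<open>C1_0 a b\<close>; as a functional on \<open>C1_0 a b\<close> the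
  derivative is unique, but its values outside this set are unconstrained.\<close>

definition has_C1_0_frechet_derivative :: "real \<Rightarrow> real \<Rightarrow>
    ((real \<Rightarrow> 'b::real_normed_vector) \<Rightarrow> real) \<Rightarrow> (real \<Rightarrow> 'b) \<Rightarrow> ((real \<Rightarrow> 'b) \<Rightarrow> real) \<Rightarrow> bool" where
  "has_C1_0_frechet_derivative a b \<phi> u \<xi> \<longleftrightarrow> C1_0_dual a b \<xi> \<and>
     (\<forall>\<epsilon>>0. \<exists>\<delta>>0. \<forall>v\<in>C1_0 a b. C1_norm a b v < \<delta> \<longrightarrow>
        \<bar>\<phi> (\<lambda>t. u t + v t) - \<phi> u - \<xi> v\<bar> \<le> \<epsilon> * C1_norm a b v)"

definition C1_0_frechet_derivative :: "real \<Rightarrow> real \<Rightarrow>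
    ((real \<Rightarrow> 'b::real_normed_vector) \<Rightarrow> real) \<Rightarrow> (real \<Rightarrow> 'b) \<Rightarrow> (real \<Rightarrow> 'b) \<Rightarrow> real" where
  "C1_0_frechet_derivative a b \<phi> u = (SOME \<xi>. has_C1_0_frechet_derivative a b \<phi> u \<xi>)"

definition zeta_diff :: "'c::real_inner \<Rightarrow> 'c set \<Rightarrow> 'c set \<Rightarrow> 'c set" where
  "zeta_diff \<zeta> D E = {z. (\<lambda>e. z + e) ` E \<subseteq> closure {x + h | x h. x \<in> D \<and> h \<in> H_plus \<zeta>}}"

definition set_seq_lim :: "(nat \<Rightarrow> 'c::topological_space set) \<Rightarrow> 'c set" where
  "set_seq_lim D = {z. \<exists>w. (\<forall>k. w k \<in> D k) \<and> w \<longlonglongrightarrow> z}"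

definition has_set_lim_0_right :: "(real \<Rightarrow> 'c::topological_space set) \<Rightarrow> 'c set \<Rightarrow> bool" where
  "has_set_lim_0_right D E \<longleftrightarrow>
     (\<forall>s. (\<forall>k. s k > 0) \<and> s \<longlonglongrightarrow> 0 \<longrightarrow> set_seq_lim (\<lambda>k. D (s k)) = E)"

text \<open>The derivative of \<open>f\<close> with respect to \<open>\<zeta>\<close> at \<open>x\<^sub>0\<close> in direction \<open>v\<close> exists and equals \<open>E\<close>.\<close>

definition has_zeta_derivative :: "'c::real_inner \<Rightarrow>
    ((real \<Rightarrow> 'b::real_vector) \<Rightarrow> 'c set) \<Rightarrow> (real \<Rightarrow> 'b) \<Rightarrow> (real \<Rightarrow> 'b) \<Rightarrow> 'c set \<Rightarrow> bool" where
  "has_zeta_derivative \<zeta> f x\<^sub>0 v E \<longleftrightarrow>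
     has_set_lim_0_right
       (\<lambda>s. (\<lambda>z. (1 / s) *\<^sub>R z) ` zeta_diff \<zeta> (f (\<lambda>t. x\<^sub>0 t + s *\<^sub>R v t)) (f x\<^sub>0)) E"

end

theory Submission
  imports Defs
begin

text \<open>All arcs \<open>y + v\<close> with \<open>y \<in> M\<close> are admissible, hence
  \<open>\<phi> 0 \<le> \<phi> v \<le> J\<^sub>\<zeta> (y\<^sub>\<zeta> + v)\<close> with equality at \<open>v = 0\<close>. The upper bound is Frechet
  differentiable and minimal at \<open>0\<close>, so its derivative there vanishes, and \<open>\<phi>\<close>, squeezed in between,
  has derivative zero as well. The \<open>\<zeta>\<close>-difference quotients are half-spaces normal to \<open>\<zeta>\<close> whose
  offset is the difference quotient of \<open>\<phi>\<close>.\<close>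

section \<open>Continuously differentiable arcs\<close>

text \<open>A linear map on the reals is determined by its value at 1, so the operator-valued
  derivative and its continuity pass to the velocity. As \<open>a < b\<close>, derivatives within
  the interval are unique, end points included, which identifies \<open>dot\<close> with that
  value.\<close>

lemma C1_on_interval_derivative:
  assumes "a < b" "C1_on {a..b} y"
  shows C1_on_has_vector_derivative_dot:
      "t \<in> {a..b} \<Longrightarrow> (y has_vector_derivative dot a b y t) (at t within {a..b})"
    and C1_on_continuous_on_dot: "continuous_on {a..b} (dot a b y)"
    and C1_on_continuous_on: "continuous_on {a..b} y"
proof -
  obtain f' where f': "\<And>t. t \<in> {a..b} \<Longrightarrow> (y has_derivative blinfun_apply (f' t)) (at t within {a..b})"
    and cont: "continuous_on {a..b} f'"
    using assms(2) unfolding C1_on_def by blast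
  have vd: "(y has_vector_derivative blinfun_apply (f' t) 1) (at t within {a..b})"
    if "t \<in> {a..b}" for t
  proof -
    have "blinfun_apply (f' t) x = x *\<^sub>R blinfun_apply (f' t) 1" for x
      by (metis blinfun.scaleR_right mult.right_neutral real_scaleR_def)
    then have "blinfun_apply (f' t) = (\<lambda>x. x *\<^sub>R blinfun_apply (f' t) 1)" by blast
    then show ?thesis using f'[OF that] unfolding has_vector_derivative_def by metis
  qed
  have eq: "dot a b y t = blinfun_apply (f' t) 1" if "t \<in> {a..b}" for t
    unfolding dot_def using vector_derivative_within_cbox[of a b t y] vd[OF that] that assms(1)
    by simp
  show "(y has_vector_derivative dot a b y t) (at t within {a..b})" if "t \<in> {a..b}" for t
    using vd[OF that] eq[OF that] by simp
  show "continuous_on {a..b} (dot a b y)"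
    by (subst continuous_on_cong[OF refl eq]) (auto intro!: continuous_intros cont)
  show "continuous_on {a..b} y"
    by (rule has_derivative_continuous_on[OF f'])
qed

section \<open>Linear structure of arcs and variations\<close>

lemma dot_eqI:
  assumes "a < b" "t \<in> {a..b}" "(y has_vector_derivative y') (at t within {a..b})"
  shows "dot a b y t = y'"
  unfolding dot_def using vector_derivative_within_cbox[of a b t y] assms by simp

lemma dot_add:
  assumes "a < b" "C1_on {a..b} u" "C1_on {a..b} v" "t \<in> {a..b}"
  shows "dot a b (\<lambda>t. u t + v t) t = dot a b u t + dot a b v t"
  using assms by (intro dot_eqI has_vector_derivative_add C1_on_has_vector_derivative_dot)

lemma dot_scaleR:
  assumes "a < b" "C1_on {a..b} v" "t \<in> {a..b}"
  shows "dot a b (\<lambda>t. c *\<^sub>R v t) t = c *\<^sub>R dot a b v t"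
  by (rule dot_eqI[OF assms(1,3) bounded_linear.has_vector_derivative
        [OF bounded_linear_scaleR_right C1_on_has_vector_derivative_dot[OF assms]]])

lemma C1_on_add:
  assumes "C1_on S f" "C1_on S g"
  shows "C1_on S (\<lambda>x. f x + g x)"
proof -
  obtain f' g' where "\<forall>x\<in>S. (f has_derivative blinfun_apply (f' x)) (at x within S)"
      "continuous_on S f'" "\<forall>x\<in>S. (g has_derivative blinfun_apply (g' x)) (at x within S)"
      "continuous_on S g'"
    using assms unfolding C1_on_def by blast
  then show ?thesis
    unfolding C1_on_def
    by (intro exI[of _ "\<lambda>x. f' x + g' x"])
      (auto simp: plus_blinfun.rep_eq intro!: continuous_intros has_derivative_add)
qed

lemma C1_on_scaleR:
  assumes "C1_on S f"
  shows "C1_on S (\<lambda>x. c *\<^sub>R f x)"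
proof -
  obtain f' where "\<forall>x\<in>S. (f has_derivative blinfun_apply (f' x)) (at x within S)"
      "continuous_on S f'"
    using assms unfolding C1_on_def by blast
  then show ?thesis
    unfolding C1_on_def
    by (intro exI[of _ "\<lambda>x. c *\<^sub>R f' x"])
      (auto simp: scaleR_blinfun.rep_eq intro!: continuous_intros has_derivative_scaleR_right)
qed

lemma zero_in_C1_0: "(\<lambda>_. 0) \<in> C1_0 a b"
  unfolding C1_0_def C1_on_def
  by (auto intro!: exI[of _ "\<lambda>_. 0"] continuous_intros simp: zero_blinfun.rep_eq)

lemma C1_0_scaleR: "v \<in> C1_0 a b \<Longrightarrow> (\<lambda>t. c *\<^sub>R v t) \<in> C1_0 a b"
  unfolding C1_0_def by (auto intro: C1_on_scaleR)

lemma admissible_arcs_add_C1_0: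
  "y \<in> admissible_arcs a b A B \<Longrightarrow> v \<in> C1_0 a b \<Longrightarrow> (\<lambda>t. y t + v t) \<in> admissible_arcs a b A B"
  unfolding admissible_arcs_def C1_0_def by (auto intro: C1_on_add)

text \<open>Continuity on a compact interval. This makes the real suprema in \<open>C1_norm\<close>
  genuine upper bounds of the pointwise norms.\<close>

lemma C1_on_bdd_above_norm:
  assumes "a < b" "C1_on {a..b} v"
  shows "bdd_above ((\<lambda>t. norm (v t)) ` {a..b})"
    and "bdd_above ((\<lambda>t. norm (dot a b v t)) ` {a..b})"
  by (intro bounded_imp_bdd_above compact_imp_bounded compact_continuous_image
      continuous_intros compact_Icc C1_on_continuous_on[OF assms] C1_on_continuous_on_dot[OF assms])+

lemma norm_add_norm_dot_le_C1_norm: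
  assumes "a < b" "C1_on {a..b} v" "t \<in> {a..b}"
  shows "norm (v t) + norm (dot a b v t) \<le> C1_norm a b v"
  unfolding C1_norm_def
  by (intro add_mono cSUP_upper assms(3) C1_on_bdd_above_norm[OF assms(1,2)])

lemma C1_norm_nonneg: "a < b \<Longrightarrow> C1_on {a..b} v \<Longrightarrow> 0 \<le> C1_norm a b v"
  using norm_add_norm_dot_le_C1_norm[of a b v a]
  by (smt (verit) atLeastAtMost_iff norm_ge_zero)

lemma C1_norm_scaleR_le:
  assumes "a < b" "C1_on {a..b} v"
  shows "C1_norm a b (\<lambda>t. c *\<^sub>R v t) \<le> \<bar>c\<bar> * C1_norm a b v"
proof -
  have "(SUP t\<in>{a..b}. norm (c *\<^sub>R v t)) \<le> \<bar>c\<bar> * (SUP t\<in>{a..b}. norm (v t))"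
    using assms(1) unfolding norm_scaleR
    by (intro cSUP_least mult_left_mono cSUP_upper C1_on_bdd_above_norm[OF assms]) auto
  moreover have "(SUP t\<in>{a..b}. norm (dot a b (\<lambda>t. c *\<^sub>R v t) t))
      \<le> \<bar>c\<bar> * (SUP t\<in>{a..b}. norm (dot a b v t))"
  proof (rule cSUP_least)
    fix t assume t: "t \<in> {a..b}"
    show "norm (dot a b (\<lambda>t. c *\<^sub>R v t) t) \<le> \<bar>c\<bar> * (SUP t\<in>{a..b}. norm (dot a b v t))"
      unfolding dot_scaleR[OF assms t] norm_scaleR
      by (intro mult_left_mono cSUP_upper t C1_on_bdd_above_norm[OF assms]) auto
  qed (use assms(1) in simp)
  ultimately show ?thesis unfolding C1_norm_def by (simp add: distrib_left)
qed

section \<open>Frechet derivatives\<close>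

text \<open>Take the increment \<open>s *\<^sub>R v\<close> in the Frechet estimate and divide by
  \<open>s\<close>: the remainder is o(s) because the norm of the increment is at most |s| times
  that of \<open>v\<close>.\<close>

lemma frechet_derivative_direction:
  assumes "a < b" and deriv: "has_C1_0_frechet_derivative a b \<phi> u \<xi>" and v: "v \<in> C1_0 a b"
  shows "((\<lambda>s. (\<phi> (\<lambda>t. u t + s *\<^sub>R v t) - \<phi> u) / s) \<longlongrightarrow> \<xi> v) (at 0)"
proof (rule LIM_I)
  fix r :: real
  assume "r > 0"
  \<comment> \<open>Adding 1 keeps \<open>N\<close> positive for \<open>v = 0\<close>. With
    tolerance \<open>r / (2 * N)\<close> the remainder at \<open>s *\<^sub>R v\<close> is at most
    |s| r / 2, hence strictly below |s| r.\<close>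
  define N where "N = C1_norm a b v + 1"
  have C1: "C1_on {a..b} v" using v by (simp add: C1_0_def)
  have N: "N > 0" using C1_norm_nonneg[OF assms(1) C1] by (simp add: N_def)
  obtain \<delta> where \<delta>: "\<delta> > 0" "\<And>w. w \<in> C1_0 a b \<Longrightarrow> C1_norm a b w < \<delta> \<Longrightarrow>
        \<bar>\<phi> (\<lambda>t. u t + w t) - \<phi> u - \<xi> w\<bar> \<le> (r / (2 * N)) * C1_norm a b w"
    using deriv \<open>r > 0\<close> N unfolding has_C1_0_frechet_derivative_def
    by (metis divide_pos_pos mult_pos_pos zero_less_numeral)
  show "\<exists>\<delta>'>0. \<forall>s. s \<noteq> 0 \<and> norm (s - 0) < \<delta>' \<longrightarrow>
      norm ((\<phi> (\<lambda>t. u t + s *\<^sub>R v t) - \<phi> u) / s - \<xi> v) < r"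
  proof (intro exI[of _ "\<delta> / N"] conjI allI impI)
    show "\<delta> / N > 0" using \<delta>(1) N by simp
    fix s :: real
    assume s: "s \<noteq> 0 \<and> norm (s - 0) < \<delta> / N"
    have w: "(\<lambda>t. s *\<^sub>R v t) \<in> C1_0 a b" by (rule C1_0_scaleR[OF v])
    have norm_w: "C1_norm a b (\<lambda>t. s *\<^sub>R v t) \<le> \<bar>s\<bar> * N"
      using C1_norm_scaleR_le[OF assms(1) C1, of s] by (simp add: N_def algebra_simps)
    also have "\<dots> < \<delta>" using s N by (simp add: field_simps)
    finally have "\<bar>\<phi> (\<lambda>t. u t + s *\<^sub>R v t) - \<phi> u - \<xi> (\<lambda>t. s *\<^sub>R v t)\<bar>
        \<le> (r / (2 * N)) * C1_norm a b (\<lambda>t. s *\<^sub>R v t)"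
      by (rule \<delta>(2)[OF w])
    also have "\<dots> \<le> (r / (2 * N)) * (\<bar>s\<bar> * N)"
      using \<open>r > 0\<close> N by (intro mult_left_mono norm_w) auto
    also have "\<dots> < \<bar>s\<bar> * r" using \<open>r > 0\<close> N s by simp
    finally have "\<bar>\<phi> (\<lambda>t. u t + s *\<^sub>R v t) - \<phi> u - s * \<xi> v\<bar> < \<bar>s\<bar> * r"
      using deriv v by (simp add: has_C1_0_frechet_derivative_def C1_0_dual_def)
    moreover have "(\<phi> (\<lambda>t. u t + s *\<^sub>R v t) - \<phi> u) / s - \<xi> v
        = (\<phi> (\<lambda>t. u t + s *\<^sub>R v t) - \<phi> u - s * \<xi> v) / s"
      using s by (simp add: field_simps)
    ultimately show "norm ((\<phi> (\<lambda>t. u t + s *\<^sub>R v t) - \<phi> u) / s - \<xi> v) < r"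
      using s by (simp add: field_simps)
  qed
qed

text \<open>Fermat's rule: right difference quotients at a minimum are nonnegative, so
  \<open>\<xi>\<close> is nonnegative on \<open>v\<close> and on its negative, and linearity forces
  zero.\<close>

lemma frechet_derivative_at_minimum:
  assumes "a < b" and deriv: "has_C1_0_frechet_derivative a b \<phi> u \<xi>"
    and min: "\<And>v. v \<in> C1_0 a b \<Longrightarrow> \<phi> u \<le> \<phi> (\<lambda>t. u t + v t)" and v: "v \<in> C1_0 a b"
  shows "\<xi> v = 0"
proof -
  have nonneg: "0 \<le> \<xi> w" if w: "w \<in> C1_0 a b" for w
  proof (rule tendsto_lowerbound)
    show "((\<lambda>s. (\<phi> (\<lambda>t. u t + s *\<^sub>R w t) - \<phi> u) / s) \<longlongrightarrow> \<xi> w) (at_right 0)"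
      using frechet_derivative_direction[OF assms(1) deriv w] filterlim_at_split by blast
    show "\<forall>\<^sub>F s in at_right 0. 0 \<le> (\<phi> (\<lambda>t. u t + s *\<^sub>R w t) - \<phi> u) / s"
      using min[OF C1_0_scaleR[OF w]] by (auto simp: eventually_at intro!: exI[of _ 1])
  qed simp
  have "\<xi> (\<lambda>t. (- 1) *\<^sub>R v t) = - 1 * \<xi> v"
    using deriv v unfolding has_C1_0_frechet_derivative_def C1_0_dual_def by blast
  with nonneg[OF v] nonneg[OF C1_0_scaleR[OF v, of "- 1"]] show ?thesis by simp
qed

text \<open>The increment of \<open>\<phi>\<close> lies between 0 and that of \<open>\<psi>\<close>,
  which is all remainder since \<open>\<xi>\<close> vanishes. Hence the \<delta> that serves
  \<open>\<psi>\<close> serves \<open>\<phi>\<close>.\<close>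

lemma frechet_derivative_zero_squeeze:
  assumes deriv: "has_C1_0_frechet_derivative a b \<psi> u \<xi>" and \<xi>: "\<And>v. v \<in> C1_0 a b \<Longrightarrow> \<xi> v = 0"
    and eq: "\<phi> u = \<psi> u"
    and lower: "\<And>v. v \<in> C1_0 a b \<Longrightarrow> \<phi> u \<le> \<phi> (\<lambda>t. u t + v t)"
    and upper: "\<And>v. v \<in> C1_0 a b \<Longrightarrow> \<phi> (\<lambda>t. u t + v t) \<le> \<psi> (\<lambda>t. u t + v t)"
  shows "has_C1_0_frechet_derivative a b \<phi> u (\<lambda>_. 0)"
proof -
  have "\<bar>\<phi> (\<lambda>t. u t + v t) - \<phi> u - 0\<bar> \<le> \<bar>\<psi> (\<lambda>t. u t + v t) - \<psi> u - \<xi> v\<bar>"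
    if "v \<in> C1_0 a b" for v
    using \<xi>[OF that] lower[OF that] upper[OF that] eq by linarith
  moreover have "C1_0_dual a b (\<lambda>_. 0)"
    unfolding C1_0_dual_def by (auto intro!: exI[of _ 0])
  moreover have "\<exists>\<delta>>0. \<forall>v\<in>C1_0 a b. C1_norm a b v < \<delta> \<longrightarrow>
      \<bar>\<psi> (\<lambda>t. u t + v t) - \<psi> u - \<xi> v\<bar> \<le> \<epsilon> * C1_norm a b v" if "\<epsilon> > 0" for \<epsilon>
    using deriv that unfolding has_C1_0_frechet_derivative_def by blast
  ultimately show ?thesis
    unfolding has_C1_0_frechet_derivative_def by (force intro: order_trans)
qed

section \<open>The first variation\<close>

text \<open>The point is that \<open>\<delta>\<close> does not depend on \<open>t\<close>. The
  domain of \<open>L\<close> is not compact, so uniform continuity of \<open>L'\<close> is obtained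
  on a compact tube around the curve (t, y t, z t), and the mean value inequality is applied along
  segments inside it.\<close>

lemma lagrangian_linearization:
  fixes y :: "real \<Rightarrow> 'b::euclidean_space" and L :: "real \<times> 'b \<times> 'b \<Rightarrow> 'c::real_normed_vector"
  assumes L': "\<And>x. x \<in> {a..b} \<times> UNIV \<times> UNIV \<Longrightarrow>
        (L has_derivative blinfun_apply (L' x)) (at x within {a..b} \<times> UNIV \<times> UNIV)"
    and cont: "continuous_on ({a..b} \<times> UNIV \<times> UNIV) L'"
    and y: "continuous_on {a..b} y" and z: "continuous_on {a..b} z" and "\<epsilon> > 0"
  obtains \<delta> where "\<delta> > 0" "\<And>t p q. t \<in> {a..b} \<Longrightarrow> norm p + norm q < \<delta> \<Longrightarrow>
      norm (L (t, y t + p, z t + q) - L (t, y t, z t) - blinfun_apply (L' (t, y t, z t)) (0, p, q))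
        \<le> \<epsilon> * (norm p + norm q)"
proof -
  \<comment> \<open>The tube of radius 1 in both vector slots: a continuous image of a compact
    product.\<close>
  define K where "K = (\<lambda>(t, p, q). (t, y t + p, z t + q)) ` ({a..b} \<times> cball 0 1 \<times> cball 0 1)"
  have yz: "continuous_on ({a..b} \<times> cball (0::'b) 1 \<times> cball (0::'b) 1) (\<lambda>x. y (fst x))"
    "continuous_on ({a..b} \<times> cball (0::'b) 1 \<times> cball (0::'b) 1) (\<lambda>x. z (fst x))"
    by (auto intro!: continuous_on_compose2[OF y] continuous_on_compose2[OF z] continuous_intros)
  have "compact K"
    unfolding K_def case_prod_unfold
    by (intro compact_continuous_image compact_Times compact_Icc compact_cball continuous_intros yz)
  moreover have K: "K \<subseteq> {a..b} \<times> UNIV \<times> UNIV" unfolding K_def by auto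
  ultimately have "uniformly_continuous_on K L'"
    using compact_uniformly_continuous continuous_on_subset[OF cont] by blast
  then obtain \<eta> where \<eta>: "\<eta> > 0"
      "\<And>x x'. x \<in> K \<Longrightarrow> x' \<in> K \<Longrightarrow> dist x' x < \<eta> \<Longrightarrow> dist (L' x') (L' x) < \<epsilon>"
    unfolding uniformly_continuous_on_def using \<open>\<epsilon> > 0\<close> by blast
  show ?thesis
  \<comment> \<open>The bound 1 keeps the segment inside \<open>K\<close>; the bound
    \<open>\<eta>\<close> makes \<open>L'\<close> vary by less than \<open>\<epsilon>\<close> along
    it.\<close>
  proof (rule that[of "min \<eta> 1"])
    show "min \<eta> 1 > 0" using \<eta>(1) by simp
    fix t and p q :: 'b
    assume t: "t \<in> {a..b}" and pq: "norm p + norm q < min \<eta> 1"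
    define x where "x = (t, y t, z t)"
    \<comment> \<open>The time increment is zero, so the segment from \<open>x\<close> to
      \<open>x + h\<close> stays in the domain even when \<open>t\<close> is an end point.\<close>
    define h :: "real \<times> 'b \<times> 'b" where "h = (0, p, q)"
    define S where "S = (\<lambda>s. x + s *\<^sub>R h) ` {0..1}"
    have h: "norm h \<le> norm p + norm q"
      unfolding h_def using norm_Pair_le[of "0::real" "(p, q)"] norm_Pair_le[of p q] by simp
    have S_K: "S \<subseteq> K"
    proof
      fix x' assume "x' \<in> S"
      then obtain s where s: "s \<in> {0..1}" "x' = x + s *\<^sub>R h" unfolding S_def by blast
      have "norm p \<le> 1" "norm q \<le> 1"
        using pq norm_ge_zero[of p] norm_ge_zero[of q] by linarith+
      then have "norm (s *\<^sub>R p) \<le> 1" "norm (s *\<^sub>R q) \<le> 1"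
        using s(1) by (auto intro!: mult_le_one)
      then have "(t, s *\<^sub>R p, s *\<^sub>R q) \<in> {a..b} \<times> cball 0 1 \<times> cball 0 1"
        using t by simp
      moreover have "x' = (\<lambda>(t, p, q). (t, y t + p, z t + q)) (t, s *\<^sub>R p, s *\<^sub>R q)"
        by (simp add: s x_def h_def)
      ultimately show "x' \<in> K" unfolding K_def by blast
    qed
    have x_S: "x \<in> S" unfolding S_def by (rule image_eqI[of _ _ 0]) auto
    \<comment> \<open>Mean value inequality for \<open>L\<close> minus its linearization at
      \<open>x\<close>: the constant is the largest deviation of \<open>L'\<close> from
      \<open>L' x\<close> on the segment.\<close>
    have "norm (L (x + h) - L x - blinfun_apply (L' x) (x + h - x)) \<le> norm (x + h - x) * \<epsilon>"
    proof (rule differentiable_bound_linearization)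
      show "x + s *\<^sub>R (x + h - x) \<in> S" if "s \<in> {0..1}" for s
        unfolding S_def using that by (intro image_eqI[of _ _ s]) simp_all
      show "(L has_derivative blinfun_apply (L' x')) (at x' within S)" if "x' \<in> S" for x'
        using L'[of x'] has_derivative_subset that S_K K by blast
      show "onorm (blinfun_apply (L' x') - blinfun_apply (L' x)) \<le> \<epsilon>" if x': "x' \<in> S" for x'
      proof -
        obtain s where s: "s \<in> {0..1}" "x' = x + s *\<^sub>R h" using x' unfolding S_def by blast
        have "dist x' x \<le> norm h"
          using s(1) by (simp add: s(2) dist_norm mult_left_le_one_le)
        then have "dist x' x < \<eta>" using h pq by simp
        then have "dist (L' x') (L' x) < \<epsilon>" using \<eta>(2) x' x_S S_K by blast
        then show ?thesis
          by (simp add: dist_norm norm_blinfun.rep_eq blinfun.diff_left[abs_def] fun_diff_def)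
      qed
      show "x \<in> S" by (rule x_S)
    qed
    also have "\<dots> \<le> \<epsilon> * (norm p + norm q)" using h \<open>\<epsilon> > 0\<close> by simp
    finally show "norm (L (t, y t + p, z t + q) - L (t, y t, z t)
        - blinfun_apply (L' (t, y t, z t)) (0, p, q)) \<le> \<epsilon> * (norm p + norm q)"
      by (simp add: x_def h_def)
  qed
qed

text \<open>The derivative is the classical first variation. Integrating the uniform linearization
  of \<open>L\<close> along \<open>y\<close> bounds the remainder by the C1 norm of
  \<open>v\<close>.\<close>

lemma J_scalar_frechet_differentiable:
  fixes y :: "real \<Rightarrow> 'b::euclidean_space" and L :: "real \<times> 'b \<times> 'b \<Rightarrow> 'c::euclidean_space"
  assumes "a < b" and L: "C1_on ({a..b} \<times> UNIV \<times> UNIV) L" and y: "C1_on {a..b} y"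
  shows "\<exists>\<xi>. has_C1_0_frechet_derivative a b (\<lambda>v. J_scalar a b L \<zeta> (\<lambda>t. y t + v t)) (\<lambda>_. 0) \<xi>"
proof -
  let ?S = "{a..b} \<times> (UNIV :: 'b set) \<times> (UNIV :: 'b set)"
  obtain L' where L': "\<And>x. x \<in> ?S \<Longrightarrow> (L has_derivative blinfun_apply (L' x)) (at x within ?S)"
    and contL': "continuous_on ?S L'"
    using L unfolding C1_on_def by blast
  have contL: "continuous_on ?S L"
    by (rule has_derivative_continuous_on[OF L'])
  note cont = C1_on_continuous_on[OF assms(1)] C1_on_continuous_on_dot[OF assms(1)]
  define G where "G t = L' (t, y t, dot a b y t)" for t
  \<comment> \<open>The first variation paired with \<open>\<zeta>\<close>; the slot for time is 0
    because only position and velocity are varied.\<close>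
  define \<xi> where "\<xi> v = \<zeta> \<bullet> integral {a..b} (\<lambda>t. blinfun_apply (G t) (0, v t, dot a b v t))" for v
  have contG: "continuous_on {a..b} G"
    unfolding G_def by (rule continuous_on_compose2[OF contL']) (auto intro!: continuous_intros cont[OF y])
  have contGv: "continuous_on {a..b} (\<lambda>t. blinfun_apply (G t) (0, v t, dot a b v t))"
    if "C1_on {a..b} v" for v
    by (intro continuous_intros contG cont[OF that])
  have contLv: "continuous_on {a..b} (\<lambda>t. L (t, v t, dot a b v t))" if "C1_on {a..b} v" for v
    by (rule continuous_on_compose2[OF contL]) (auto intro!: continuous_intros cont[OF that])
  have C1: "C1_on {a..b} v" if "v \<in> C1_0 a b" for v using that by (simp add: C1_0_def)
  have dual: "C1_0_dual a b \<xi>"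
    unfolding C1_0_dual_def
  proof (intro conjI ballI allI)
    fix u v :: "real \<Rightarrow> 'b"
    assume uv: "u \<in> C1_0 a b" "v \<in> C1_0 a b"
    have "integral {a..b} (\<lambda>t. blinfun_apply (G t) (0, u t + v t, dot a b (\<lambda>t. u t + v t) t))
        = integral {a..b} (\<lambda>t. blinfun_apply (G t) (0, u t, dot a b u t)
            + blinfun_apply (G t) (0, v t, dot a b v t))"
      by (rule integral_cong)
        (simp add: dot_add[OF assms(1) C1[OF uv(1)] C1[OF uv(2)]] blinfun.add_right[symmetric])
    then show "\<xi> (\<lambda>t. u t + v t) = \<xi> u + \<xi> v"
      unfolding \<xi>_def using contGv[OF C1[OF uv(1)]] contGv[OF C1[OF uv(2)]]
      by (simp add: Henstock_Kurzweil_Integration.integral_add integrable_continuous_interval inner_add_right)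
  next
    fix c and v :: "real \<Rightarrow> 'b"
    assume v: "v \<in> C1_0 a b"
    have "integral {a..b} (\<lambda>t. blinfun_apply (G t) (0, c *\<^sub>R v t, dot a b (\<lambda>t. c *\<^sub>R v t) t))
        = integral {a..b} (\<lambda>t. c *\<^sub>R blinfun_apply (G t) (0, v t, dot a b v t))"
      by (rule integral_cong)
        (simp add: dot_scaleR[OF assms(1) C1[OF v]] blinfun.scaleR_right[symmetric])
    then show "\<xi> (\<lambda>t. c *\<^sub>R v t) = c * \<xi> v"
      unfolding \<xi>_def by simp
  next
    have "bounded (G ` {a..b})"
      by (intro compact_imp_bounded compact_continuous_image contG compact_Icc)
    then obtain K where K: "\<And>t. t \<in> {a..b} \<Longrightarrow> norm (G t) \<le> K"
      unfolding bounded_iff by blast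
    \<comment> \<open>\<open>K\<close> bounds the operator norm of \<open>G\<close>, the factor
      \<open>b - a\<close> comes from integration, and \<open>norm \<zeta>\<close> from
      Cauchy-Schwarz.\<close>
    have "\<bar>\<xi> v\<bar> \<le> (norm \<zeta> * (K * (b - a))) * C1_norm a b v" if v: "v \<in> C1_0 a b" for v
    proof -
      have "norm (integral {a..b} (\<lambda>t. blinfun_apply (G t) (0, v t, dot a b v t)))
          \<le> (K * C1_norm a b v) * (b - a)"
      proof (rule integral_bound)
        fix t assume t: "t \<in> {a..b}"
        have "norm (0::real, v t, dot a b v t) \<le> C1_norm a b v"
          using norm_Pair_le[of "0::real" "(v t, dot a b v t)"] norm_Pair_le[of "v t" "dot a b v t"]
            norm_add_norm_dot_le_C1_norm[OF assms(1) C1[OF v] t] by simp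
        then show "norm (blinfun_apply (G t) (0, v t, dot a b v t)) \<le> K * C1_norm a b v"
          using K[OF t] by (intro order_trans[OF norm_blinfun] mult_mono)
            (auto intro: order_trans[OF norm_ge_zero])
      qed (use assms(1) contGv[OF C1[OF v]] in auto)
      then have "norm \<zeta> * norm (integral {a..b} (\<lambda>t. blinfun_apply (G t) (0, v t, dot a b v t)))
          \<le> norm \<zeta> * ((K * C1_norm a b v) * (b - a))"
        by (intro mult_left_mono) auto
      then show ?thesis
        unfolding \<xi>_def
        by (intro order_trans[OF Cauchy_Schwarz_ineq2]) (simp add: algebra_simps)
    qed
    then show "\<exists>K. \<forall>v\<in>C1_0 a b. \<bar>\<xi> v\<bar> \<le> K * C1_norm a b v" by blast
  qed
  \<comment> \<open>The summands 0 come from instantiating the Frechet estimate at the base point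
    \<open>\<lambda>_. 0\<close>.\<close>
  have "\<exists>\<delta>>0. \<forall>v\<in>C1_0 a b. C1_norm a b v < \<delta> \<longrightarrow>
      \<bar>J_scalar a b L \<zeta> (\<lambda>t. y t + (0 + v t)) - J_scalar a b L \<zeta> (\<lambda>t. y t + 0) - \<xi> v\<bar>
        \<le> \<epsilon> * C1_norm a b v" if "\<epsilon> > 0" for \<epsilon>
  proof -
    \<comment> \<open>Pairing with \<open>\<zeta>\<close> and integrating cost at most the factor
      \<open>(norm \<zeta> + 1) * (b - a)\<close>, divided out in advance. The 1 keeps it positive
      for \<open>\<zeta> = 0\<close>.\<close>
    define e where "e = \<epsilon> / ((norm \<zeta> + 1) * (b - a))"
    have pos: "(norm \<zeta> + 1) * (b - a) > 0" using assms(1) by (simp add: add_nonneg_pos)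
    have e: "e > 0" unfolding e_def using that pos by simp
    have e_eq: "e * ((norm \<zeta> + 1) * (b - a)) = \<epsilon>"
      unfolding e_def by (rule nonzero_eq_divide_eq[THEN iffD1, OF _ refl]) (use pos in linarith)
    obtain \<delta> where \<delta>: "\<delta> > 0" "\<And>t p q. t \<in> {a..b} \<Longrightarrow> norm p + norm q < \<delta> \<Longrightarrow>
        norm (L (t, y t + p, dot a b y t + q) - L (t, y t, dot a b y t)
          - blinfun_apply (G t) (0, p, q)) \<le> e * (norm p + norm q)"
      using lagrangian_linearization[OF L' contL' cont(1)[OF y] cont(2)[OF y] e]
      unfolding G_def by metis
    have "\<bar>J_scalar a b L \<zeta> (\<lambda>t. y t + v t) - J_scalar a b L \<zeta> y - \<xi> v\<bar> \<le> \<epsilon> * C1_norm a b v"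
      if v: "v \<in> C1_0 a b" and small: "C1_norm a b v < \<delta>" for v
    proof -
      \<comment> \<open>The pointwise remainder of \<open>L\<close>; its integral paired with
        \<open>\<zeta>\<close> is exactly the Frechet remainder.\<close>
      define r where "r t = L (t, y t + v t, dot a b (\<lambda>t. y t + v t) t) - L (t, y t, dot a b y t)
        - blinfun_apply (G t) (0, v t, dot a b v t)" for t
      note c = contLv[OF C1_on_add[OF y C1[OF v]]] contLv[OF y] contGv[OF C1[OF v]]
      have "norm (integral {a..b} r) \<le> (e * C1_norm a b v) * (b - a)"
      proof (rule integral_bound)
        show "continuous_on {a..b} r" unfolding r_def by (intro continuous_intros c)
        fix t assume t: "t \<in> {a..b}"
        note le = norm_add_norm_dot_le_C1_norm[OF assms(1) C1[OF v] t]
        have "norm (r t) \<le> e * (norm (v t) + norm (dot a b v t))"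
          unfolding r_def dot_add[OF assms(1) y C1[OF v] t]
          using le small by (intro \<delta>(2)[OF t]) simp
        also have "\<dots> \<le> e * C1_norm a b v" using le e by (simp add: mult_left_mono)
        finally show "norm (r t) \<le> e * C1_norm a b v" .
      qed (use assms(1) in simp)
      moreover have "J_scalar a b L \<zeta> (\<lambda>t. y t + v t) - J_scalar a b L \<zeta> y - \<xi> v
          = \<zeta> \<bullet> integral {a..b} r"
        unfolding J_scalar_def J_def \<xi>_def r_def using c
        by (simp add: Henstock_Kurzweil_Integration.integral_diff integrable_continuous_interval
            integrable_diff inner_diff_right)
      ultimately have "\<bar>J_scalar a b L \<zeta> (\<lambda>t. y t + v t) - J_scalar a b L \<zeta> y - \<xi> v\<bar>
          \<le> norm \<zeta> * ((e * C1_norm a b v) * (b - a))"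
        by (simp add: order_trans[OF Cauchy_Schwarz_ineq2] mult_left_mono)
      also have "\<dots> \<le> (norm \<zeta> + 1) * ((e * C1_norm a b v) * (b - a))"
        using e assms(1) C1_norm_nonneg[OF assms(1) C1[OF v]] by (intro mult_right_mono) auto
      also have "\<dots> = e * ((norm \<zeta> + 1) * (b - a)) * C1_norm a b v" by simp
      also have "\<dots> = \<epsilon> * C1_norm a b v" by (simp only: e_eq)
      finally show ?thesis .
    qed
    then show ?thesis using \<delta>(1) by auto
  qed
  with dual show ?thesis
    unfolding has_C1_0_frechet_derivative_def by blast
qed

section \<open>Half-spaces and the derivative with respect to \<open>\<zeta>\<close>\<close>

text \<open>Adding the half-space erases everything about \<open>D\<close> except the infimum of
  \<open>\<zeta>\<close> over it. The closure supplies the boundary hyperplane when that infimum is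
  not attained.\<close>

lemma closure_plus_H_plus:
  assumes "\<zeta> \<noteq> 0" "D \<noteq> {}" "bdd_below ((\<lambda>x. \<zeta> \<bullet> x) ` D)"
  shows "closure {x + h | x h. x \<in> D \<and> h \<in> H_plus \<zeta>} = {z. (INF x\<in>D. \<zeta> \<bullet> x) \<le> \<zeta> \<bullet> z}"
    (is "closure ?A = ?B")
proof
  have "(INF x\<in>D. \<zeta> \<bullet> x) \<le> \<zeta> \<bullet> (x + h)" if "x \<in> D" "h \<in> H_plus \<zeta>" for x h
    using cINF_lower[OF assms(3) that(1)] that(2) by (simp add: H_plus_def inner_add_right)
  then have "?A \<subseteq> ?B" by blast
  then show "closure ?A \<subseteq> ?B"
    by (rule closure_minimal) (intro closed_Collect_le continuous_intros)
next
  show "?B \<subseteq> closure ?A"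
  proof
    fix z assume z: "z \<in> ?B"
    show "z \<in> closure ?A"
      unfolding closure_approachable
    proof (intro allI impI)
      fix e :: real assume e: "e > 0"
      \<comment> \<open>Moving \<open>z\<close> by \<open>c *\<^sub>R \<zeta>\<close>, a vector of
        length \<open>e / 2\<close>, lifts it strictly above the infimum, so some point of
        \<open>D\<close> lies below it in direction \<open>\<zeta>\<close>.\<close>
      define c where "c = e / (2 * norm \<zeta>)"
      have c: "c > 0" using e assms(1) by (simp add: c_def)
      have "(INF x\<in>D. \<zeta> \<bullet> x) < \<zeta> \<bullet> (z + c *\<^sub>R \<zeta>)"
        using z mult_pos_pos[OF c, of "\<zeta> \<bullet> \<zeta>"] assms(1) by (simp add: inner_add_right)
      then obtain x where x: "x \<in> D" "\<zeta> \<bullet> x < \<zeta> \<bullet> (z + c *\<^sub>R \<zeta>)"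
        using cINF_less_iff[OF assms(2,3)] by blast
      then have "z + c *\<^sub>R \<zeta> - x \<in> H_plus \<zeta>"
        by (simp add: H_plus_def inner_diff_right)
      then have "z + c *\<^sub>R \<zeta> \<in> ?A"
        using x(1) by (intro CollectI exI[of _ x] exI[of _ "z + c *\<^sub>R \<zeta> - x"]) simp
      moreover have "dist (z + c *\<^sub>R \<zeta>) z < e"
        using e c assms(1) by (simp add: dist_norm) (simp add: c_def)
      ultimately show "\<exists>w\<in>?A. dist w z < e" by blast
    qed
  qed
qed

text \<open>The inclusion of \<open>z + E\<close> in a half-space is one scalar inequality for each
  point of \<open>E\<close>, equivalent to a single one for the infimum. Nonemptiness and lower
  bounds make both infima genuine real numbers.\<close>

lemma zeta_diff_eq:
  assumes "\<zeta> \<noteq> 0" "D \<noteq> {}" "bdd_below ((\<lambda>x. \<zeta> \<bullet> x) ` D)"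
    and "E \<noteq> {}" "bdd_below ((\<lambda>x. \<zeta> \<bullet> x) ` E)"
  shows "zeta_diff \<zeta> D E = {z. (INF x\<in>D. \<zeta> \<bullet> x) - (INF e\<in>E. \<zeta> \<bullet> e) \<le> \<zeta> \<bullet> z}"
proof -
  have "z \<in> zeta_diff \<zeta> D E \<longleftrightarrow> (\<forall>e\<in>E. (INF x\<in>D. \<zeta> \<bullet> x) - \<zeta> \<bullet> z \<le> \<zeta> \<bullet> e)" for z
    unfolding zeta_diff_def closure_plus_H_plus[OF assms(1-3)]
    by (auto simp: inner_add_right algebra_simps image_subset_iff)
  also have "\<dots> z \<longleftrightarrow> (INF x\<in>D. \<zeta> \<bullet> x) - \<zeta> \<bullet> z \<le> (INF e\<in>E. \<zeta> \<bullet> e)" for z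
    using le_cINF_iff[OF assms(4,5)] by blast
  finally show ?thesis by (auto simp: algebra_simps)
qed

text \<open>Parallel half-spaces converge with their offsets: inequalities pass to the limit, and
  conversely each limit point is reached by sliding it along \<open>\<zeta>\<close>.\<close>

lemma has_set_lim_0_right_halfspaces:
  assumes "\<zeta> \<noteq> 0" and lim: "(q \<longlongrightarrow> c) (at_right 0)"
    and D: "\<And>s. s > 0 \<Longrightarrow> D s = {z. q s \<le> \<zeta> \<bullet> z}"
  shows "has_set_lim_0_right D {z. c \<le> \<zeta> \<bullet> z}"
  unfolding has_set_lim_0_right_def
proof (intro allI impI)
  fix s :: "nat \<Rightarrow> real"
  assume s: "(\<forall>k. s k > 0) \<and> s \<longlonglongrightarrow> 0"
  then have "filterlim s (at_right 0) sequentially"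
    by (auto simp: filterlim_at intro!: always_eventually less_imp_neq[THEN not_sym])
  then have q: "(\<lambda>k. q (s k)) \<longlonglongrightarrow> c"
    by (rule filterlim_compose[OF lim])
  have Ds: "D (s k) = {z. q (s k) \<le> \<zeta> \<bullet> z}" for k using D s by blast
  show "set_seq_lim (\<lambda>k. D (s k)) = {z. c \<le> \<zeta> \<bullet> z}"
  proof (intro set_eqI iffI)
    fix z assume "z \<in> set_seq_lim (\<lambda>k. D (s k))"
    then obtain w where w: "\<And>k. q (s k) \<le> \<zeta> \<bullet> w k" "w \<longlonglongrightarrow> z"
      unfolding set_seq_lim_def Ds by blast
    have "(\<lambda>k. \<zeta> \<bullet> w k) \<longlonglongrightarrow> \<zeta> \<bullet> z" by (intro tendsto_intros w(2))
    then show "z \<in> {z. c \<le> \<zeta> \<bullet> z}" using LIMSEQ_le[OF q] w(1) by blast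
  next
    fix z assume z: "z \<in> {z. c \<le> \<zeta> \<bullet> z}"
    \<comment> \<open>The shift changes the pairing with \<open>\<zeta>\<close> by exactly
      \<open>q (s k) - c\<close>, which puts \<open>w k\<close> in \<open>D (s k)\<close>, and it
      tends to zero.\<close>
    define w where "w k = z + ((q (s k) - c) / (\<zeta> \<bullet> \<zeta>)) *\<^sub>R \<zeta>" for k
    have "w k \<in> D (s k)" for k
      using z assms(1) by (simp add: Ds w_def inner_add_right)
    moreover have "w \<longlonglongrightarrow> z + ((c - c) / (\<zeta> \<bullet> \<zeta>)) *\<^sub>R \<zeta>"
      unfolding w_def using assms(1) by (intro tendsto_intros q) simp
    ultimately show "z \<in> set_seq_lim (\<lambda>k. D (s k))"
      unfolding set_seq_lim_def by auto
  qed
qed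

text \<open>The \<zeta>-difference is a half-space whose offset is the increment of the infimum.
  Scaling by \<open>1 / s\<close> turns the offset into a difference quotient, which tends to
  \<open>\<xi> v\<close>.\<close>

lemma has_zeta_derivative_S_set:
  assumes "a < b" "\<zeta> \<noteq> 0" and v: "v \<in> C1_0 a b"
    and F: "\<And>u. u \<in> C1_0 a b \<Longrightarrow> F u \<noteq> {} \<and> bdd_below ((\<lambda>z. \<zeta> \<bullet> z) ` F u)"
    and deriv: "has_C1_0_frechet_derivative a b (\<lambda>u. INF z\<in>F u. \<zeta> \<bullet> z) (\<lambda>_. 0) \<xi>"
  shows "has_zeta_derivative \<zeta> F (\<lambda>_. 0) v (S_set \<xi> \<zeta> v)"
proof -
  define \<phi> where "\<phi> u = (INF z\<in>F u. \<zeta> \<bullet> z)" for u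
  have "((\<lambda>s. (\<phi> (\<lambda>t. 0 + s *\<^sub>R v t) - \<phi> (\<lambda>_. 0)) / s) \<longlongrightarrow> \<xi> v) (at_right 0)"
    using frechet_derivative_direction[OF assms(1) deriv v] filterlim_at_split
    unfolding \<phi>_def by blast
  moreover have "(\<lambda>z. (1 / s) *\<^sub>R z) ` zeta_diff \<zeta> (F (\<lambda>t. 0 + s *\<^sub>R v t)) (F (\<lambda>_. 0))
      = {z. (\<phi> (\<lambda>t. 0 + s *\<^sub>R v t) - \<phi> (\<lambda>_. 0)) / s \<le> \<zeta> \<bullet> z}" (is "?l = ?r") if s: "s > 0" for s
  proof -
    have eq: "zeta_diff \<zeta> (F (\<lambda>t. 0 + s *\<^sub>R v t)) (F (\<lambda>_. 0))
        = {z. \<phi> (\<lambda>t. 0 + s *\<^sub>R v t) - \<phi> (\<lambda>_. 0) \<le> \<zeta> \<bullet> z}"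
      unfolding \<phi>_def using F[OF C1_0_scaleR[OF v, of s]] F[OF zero_in_C1_0]
      by (intro zeta_diff_eq assms(2)) auto
    show ?thesis
    proof (intro set_eqI iffI)
      fix z assume "z \<in> ?l"
      then show "z \<in> ?r" unfolding eq using s by (auto simp: divide_right_mono)
    next
      fix z assume "z \<in> ?r"
      then show "z \<in> ?l" unfolding eq using s
        by (intro image_eqI[of _ _ "s *\<^sub>R z"]) (auto simp: field_simps)
    qed
  qed
  ultimately show ?thesis
    unfolding has_zeta_derivative_def S_set_def
    by (intro has_set_lim_0_right_halfspaces assms(2))
qed

section \<open>The squeeze for the inf-translation\<close>

theorem corollary3p9:
  fixes a b :: real
    and A B :: "real ^ 'n"
    and C :: "(real ^ 'd) set"
    and L :: "real \<times> (real ^ 'n) \<times> (real ^ 'n) \<Rightarrow> real ^ 'd"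
    and M :: "(real \<Rightarrow> real ^ 'n) set"
    and \<zeta> :: "real ^ 'd"
  assumes "a < b"
    and "CARD('d) > 1"
    and "convex_cone C" and "closed C" and "C \<noteq> UNIV"
    and "C1_on ({a..b} \<times> UNIV \<times> UNIV) L"
    and "infimizer (J_bar a b L C) (admissible_arcs a b A B) M"
    and "\<zeta> \<in> dual_cone C - {0}"
    and "\<exists>y\<in>M. zeta_solution a b A B L \<zeta> y"
  shows "let \<phi>' = C1_0_frechet_derivative a b (phi a b L C \<zeta> M) (\<lambda>_. 0) in
    has_C1_0_frechet_derivative a b (phi a b L C \<zeta> M) (\<lambda>_. 0) \<phi>' \<and>
    (\<forall>v\<in>C1_0 a b.
       has_zeta_derivative \<zeta> (J_hat a b L C M) (\<lambda>_. 0) v (S_set \<phi>' \<zeta> v) \<and>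
       S_set \<phi>' \<zeta> v = H_plus \<zeta>)"
proof -
  obtain y where "y \<in> M" and sol: "zeta_solution a b A B L \<zeta> y" using assms(9) by blast
  define \<phi> where "\<phi> = phi a b L C \<zeta> M"
  define \<psi> where "\<psi> v = J_scalar a b L \<zeta> (\<lambda>t. y t + v t)" for v
  have M: "M \<subseteq> admissible_arcs a b A B" using assms(7) by (simp add: infimizer_def)
  have y: "y \<in> admissible_arcs a b A B" using sol by (simp add: zeta_solution_def)
  have min: "J_scalar a b L \<zeta> y \<le> J_scalar a b L \<zeta> x" if "x \<in> admissible_arcs a b A B" for x
  proof -
    have "ereal (J_scalar a b L \<zeta> y) \<le> ereal (J_scalar a b L \<zeta> x)"
      using sol that unfolding zeta_solution_def by (metis INF_lower)
    then show ?thesis by simp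
  qed
  \<comment> \<open>Variations vanish at both end points, so \<open>x + v\<close> is again
    admissible and cannot beat \<open>y\<close>; \<open>\<zeta>\<close> is nonnegative on
    \<open>C\<close>; and the closed half-space absorbs the closure in \<open>J_hat\<close>.\<close>
  have lower: "J_scalar a b L \<zeta> y \<le> \<zeta> \<bullet> z" if v: "v \<in> C1_0 a b" and z: "z \<in> J_hat a b L C M v" for v z
  proof -
    have "(\<Union>y\<in>M. J_bar a b L C (\<lambda>t. y t + v t)) \<subseteq> {z. J_scalar a b L \<zeta> y \<le> \<zeta> \<bullet> z}"
    proof clarify
      fix x z assume x: "x \<in> M" "z \<in> J_bar a b L C (\<lambda>t. x t + v t)"
      then obtain c where c: "c \<in> C" "z = J a b L (\<lambda>t. x t + v t) + c" unfolding J_bar_def by blast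
      have "J_scalar a b L \<zeta> y \<le> \<zeta> \<bullet> J a b L (\<lambda>t. x t + v t)"
        using min[OF admissible_arcs_add_C1_0[OF _ v]] x(1) M unfolding J_scalar_def by blast
      moreover have "\<zeta> \<bullet> c \<ge> 0" using assms(8) c(1) by (simp add: dual_cone_def)
      ultimately show "J_scalar a b L \<zeta> y \<le> \<zeta> \<bullet> z" by (simp add: c(2) inner_add_right)
    qed
    then have "J_hat a b L C M v \<subseteq> {z. J_scalar a b L \<zeta> y \<le> \<zeta> \<bullet> z}"
      unfolding J_hat_def by (rule closure_minimal) (intro closed_Collect_le continuous_intros)
    then show ?thesis using z by blast
  qed
  \<comment> \<open>This places the value of \<open>J\<close> at \<open>y + v\<close> itself in
    \<open>J_hat\<close>, giving both nonemptiness and the upper bound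
    \<open>\<psi>\<close>.\<close>
  have "0 \<in> C" using assms(3) by (rule convex_cone_contains_0)
  then have "J a b L (\<lambda>t. y t + v t) \<in> J_bar a b L C (\<lambda>t. y t + v t)" for v
    unfolding J_bar_def by force
  then have mem: "J a b L (\<lambda>t. y t + v t) \<in> J_hat a b L C M v" for v
    unfolding J_hat_def by (rule subsetD[OF closure_subset UN_I[OF \<open>y \<in> M\<close>]])
  have J_hat: "J_hat a b L C M v \<noteq> {} \<and> bdd_below ((\<lambda>z. \<zeta> \<bullet> z) ` J_hat a b L C M v)"
    if "v \<in> C1_0 a b" for v
    using mem[of v] lower[OF that] by (auto intro!: bdd_belowI2)
  have \<phi>_le: "\<phi> v \<le> \<psi> v" if "v \<in> C1_0 a b" for v
    unfolding \<phi>_def phi_def \<psi>_def J_scalar_def using J_hat[OF that] mem[of v]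
    by (auto intro: cINF_lower)
  have \<phi>_ge: "\<psi> (\<lambda>_. 0) \<le> \<phi> v" if "v \<in> C1_0 a b" for v
    unfolding \<phi>_def phi_def \<psi>_def using J_hat[OF that] lower[OF that]
    by (auto intro: cINF_greatest)
  have \<phi>_0: "\<phi> (\<lambda>_. 0) = \<psi> (\<lambda>_. 0)"
    using \<phi>_le[OF zero_in_C1_0] \<phi>_ge[OF zero_in_C1_0] by (rule antisym)
  have "C1_on {a..b} y" using y by (simp add: admissible_arcs_def)
  then obtain \<xi> where \<xi>: "has_C1_0_frechet_derivative a b \<psi> (\<lambda>_. 0) \<xi>"
    unfolding \<psi>_def using J_scalar_frechet_differentiable[OF assms(1,6)] by blast
  have \<xi>_0: "\<xi> v = 0" if "v \<in> C1_0 a b" for v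
    by (rule frechet_derivative_at_minimum[OF assms(1) \<xi> _ that])
      (use min[OF admissible_arcs_add_C1_0[OF y]] in \<open>simp add: \<psi>_def\<close>)
  have "has_C1_0_frechet_derivative a b \<phi> (\<lambda>_. 0) (\<lambda>_. 0)"
    by (rule frechet_derivative_zero_squeeze[where \<phi> = \<phi>, OF \<xi> \<xi>_0 \<phi>_0]) (simp_all add: \<phi>_0 \<phi>_le \<phi>_ge)
  \<comment> \<open>The chosen derivative may differ from \<open>\<lambda>_. 0\<close> outside
    \<open>C1_0 a b\<close>. Its vanishing on that space follows from Fermat's rule applied to
    \<open>\<phi>\<close> itself.\<close>
  then have \<phi>': "has_C1_0_frechet_derivative a b \<phi> (\<lambda>_. 0) (C1_0_frechet_derivative a b \<phi> (\<lambda>_. 0))"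
    unfolding C1_0_frechet_derivative_def by (rule someI[where P = "has_C1_0_frechet_derivative a b \<phi> (\<lambda>_. 0)"])
  have \<phi>'_0: "C1_0_frechet_derivative a b \<phi> (\<lambda>_. 0) v = 0" if "v \<in> C1_0 a b" for v
    by (rule frechet_derivative_at_minimum[OF assms(1) \<phi>' _ that]) (simp add: \<phi>_0 \<phi>_ge)
  have "has_zeta_derivative \<zeta> (J_hat a b L C M) (\<lambda>_. 0) v
      (S_set (C1_0_frechet_derivative a b \<phi> (\<lambda>_. 0)) \<zeta> v)" if "v \<in> C1_0 a b" for v
    using \<phi>' assms(8) unfolding \<phi>_def phi_def[abs_def]
    by (intro has_zeta_derivative_S_set J_hat) (auto simp: assms(1) that)
  moreover have "S_set (C1_0_frechet_derivative a b \<phi> (\<lambda>_. 0)) \<zeta> v = H_plus \<zeta>"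
    if "v \<in> C1_0 a b" for v
    unfolding S_set_def H_plus_def using \<phi>'_0[OF that] by simp
  ultimately show ?thesis
    using \<phi>' unfolding Let_def \<phi>_def by blast
qed

end
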